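(* Let $p$ be a prime and $q=p^r$ with $r\ge 1$, and suppose that $q\ne 9$ is odd or that $q=2$. Let $u$ be a primitive element of $F=GF(q)$, and let $g_3,g_4,g_5$ be the following elements of the Paige loop $M^*(q)$: $$g_3=\begin{pmatrix}0 & (0,0,u)\\ (0,0,-u^{-1}) & 1\end{pmatrix},\quad g_4=\begin{pmatrix}0 & (0,0,u)\\ (0,u,-u^{-1}) & 1\end{pmatrix},\quad g_5=\begin{pmatrix}0 & (0,0,u)\\ (-u,0,-u^{-1}) & 1\end{pmatrix}.$$ Then each of the three subgroups $\langle g_3,g_4\rangle$, $\langle g_3,g_5\rangle$, $\langle g_4,g_5\rangle$ of $M^*(q)$ is isomorphic to the group $(3,3\,|\,3,p)$.
   Context: For a prime power $q$ let $F=GF(q)$. The Paige loop $M^*(q)$ consists of all vector matrices $$M=\begin{pmatrix} a & \alpha\\ \beta & b\end{pmatrix},\qquad a,b\in F,\ \alpha,\beta\in F^3,\qquad \det M=ab-\alpha\cdot\beta=1,$$ where $M$ is identified with $-M$ (the matrix with all entries negated). The multiplication is the Zorn multiplication $$\begin{pmatrix} a & \alpha\\ \beta & b\end{pmatrix}\begin{pmatrix} c & \gamma\\ \delta & d\end{pmatrix}=\begin{pmatrix} ac+\alpha\cdot\delta & a\gamma+d\alpha-\beta\times\delta\\ c\beta+b\delta+\alpha\times\gamma & \beta\cdot\gamma+bd\end{pmatrix},$$ where $\cdot$ and $\times$ denote the standard dot product and cross product on $F^3$. With this multiplication $M^*(q)$ is a Moufang loop. Moufang loops are diassociative, so the subloop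 $\langle g,h\rangle$ generated by any two elements $g,h$ is a group. A primitive element of $F$ is a generator of the multiplicative group $F^*$. For a positive integer $n$, $(3,3\,|\,3,n)$ denotes the group given by the presentation $\langle x,y \mid x^3=y^3=(xy)^3=(x^{-1}y)^n=1\rangle$. *)

theory Defs
  imports
    "HOL-Algebra.Group"
    "HOL-Analysis.Cartesian_Space"
    "HOL-Computational_Algebra.Primes"
begin

definition dot3 :: "'a::comm_ring_1 ^ 3 \<Rightarrow> 'a ^ 3 \<Rightarrow> 'a" where
  "dot3 x y = (\<Sum>i\<in>UNIV. x $ i * y $ i)"

definition cross3 :: "'a::comm_ring_1 ^ 3 \<Rightarrow> 'a ^ 3 \<Rightarrow> 'a ^ 3" where
  "cross3 x y = vector [x $ 2 * y $ 3 - x $ 3 * y $ 2,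
                        x $ 3 * y $ 1 - x $ 1 * y $ 3,
                        x $ 1 * y $ 2 - x $ 2 * y $ 1]"

text \<open>\<open>Zorn a \<alpha> \<beta> b\<close> is the vector matrix with rows \<open>(a, \<alpha>)\<close> and \<open>(\<beta>, b)\<close>.\<close>

datatype 'a zorn = Zorn 'a "'a ^ 3" "'a ^ 3" 'a

fun zorn_det :: "'a::comm_ring_1 zorn \<Rightarrow> 'a" where
  "zorn_det (Zorn a \<alpha> \<beta> b) = a * b - dot3 \<alpha> \<beta>"

fun zorn_uminus :: "'a::comm_ring_1 zorn \<Rightarrow> 'a zorn" where
  "zorn_uminus (Zorn a \<alpha> \<beta> b) = Zorn (- a) (- \<alpha>) (- \<beta>) (- b)"

fun zorn_mult :: "'a::comm_ring_1 zorn \<Rightarrow> 'a zorn \<Rightarrow> 'a zorn" where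
  "zorn_mult (Zorn a \<alpha> \<beta> b) (Zorn c \<gamma> \<delta> d) =
     Zorn (a * c + dot3 \<alpha> \<delta>)
          (a *s \<gamma> + d *s \<alpha> - cross3 \<beta> \<delta>)
          (c *s \<beta> + b *s \<delta> + cross3 \<alpha> \<gamma>)
          (dot3 \<beta> \<gamma> + b * d)"

definition zorn_class :: "'a::comm_ring_1 zorn \<Rightarrow> 'a zorn set" where
  "zorn_class M = {M, zorn_uminus M}"

text \<open>The Paige loop is not associative; the record type \<^typ>\<open>'a monoid\<close> only serves as a
  container for a carrier, a binary operation and a neutral element.\<close>

definition paige_loop :: "'a::field zorn set monoid" where
  "paige_loop =
     \<lparr>carrier = zorn_class ` {M. zorn_det M = 1},
      monoid.mult = (\<lambda>A B. {zorn_mult M N | M N. M \<in> A \<and> N \<in> B}),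
      one = zorn_class (Zorn 1 0 0 1)\<rparr>"

lemma zorn_class_mult:
  "zorn_class M \<otimes>\<^bsub>paige_loop\<^esub> zorn_class N = zorn_class (zorn_mult M N)"
proof -
  have d: "dot3 (- x) y = - dot3 x y" "dot3 x (- y) = - dot3 x y" for x y :: "'a ^ 3"
    by (simp_all add: dot3_def sum_negf)
  have c: "cross3 (- x) y = - cross3 x y" "cross3 x (- y) = - cross3 x y" for x y :: "'a ^ 3"
    by (simp_all add: cross3_def vec_eq_iff forall_3 vector_3)
  have s: "(- k) *s x = - (k *s x)" "k *s (- x) = - (k *s x)" for k and x :: "'a ^ 3"
    by (simp_all add: vec_eq_iff)
  have l: "zorn_mult (zorn_uminus M) N = zorn_uminus (zorn_mult M N)" for M N :: "'a zorn"
    by (cases M; cases N) (simp add: d c s)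
  have r: "zorn_mult M (zorn_uminus N) = zorn_uminus (zorn_mult M N)" for M N :: "'a zorn"
    by (cases M; cases N) (simp add: d c s)
  have u: "zorn_uminus (zorn_uminus M) = M" for M :: "'a zorn"
    by (cases M) simp
  have "zorn_class M \<otimes>\<^bsub>paige_loop\<^esub> zorn_class N =
      {zorn_mult M N, zorn_mult M (zorn_uminus N),
       zorn_mult (zorn_uminus M) N, zorn_mult (zorn_uminus M) (zorn_uminus N)}"
    unfolding paige_loop_def zorn_class_def monoid.simps by blast
  then show ?thesis
    by (auto simp: zorn_class_def l r u)
qed

text \<open>The subloop generated by \<open>A\<close>: closure under the product and under both divisions, the
  solutions \<open>z\<close> of \<open>x \<otimes> z = y\<close> and of \<open>z \<otimes> x = y\<close>.\<close>

inductive_set subloop_gen :: "('b, 'c) monoid_scheme \<Rightarrow> 'b set \<Rightarrow> 'b set"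
  for L :: "('b, 'c) monoid_scheme" and A :: "'b set" where
  incl: "x \<in> A \<Longrightarrow> x \<in> subloop_gen L A"
| one: "\<one>\<^bsub>L\<^esub> \<in> subloop_gen L A"
| mult: "x \<in> subloop_gen L A \<Longrightarrow> y \<in> subloop_gen L A \<Longrightarrow> x \<otimes>\<^bsub>L\<^esub> y \<in> subloop_gen L A"
| ldiv: "x \<in> subloop_gen L A \<Longrightarrow> y \<in> subloop_gen L A \<Longrightarrow> z \<in> carrier L \<Longrightarrow>
    x \<otimes>\<^bsub>L\<^esub> z = y \<Longrightarrow> z \<in> subloop_gen L A"
| rdiv: "x \<in> subloop_gen L A \<Longrightarrow> y \<in> subloop_gen L A \<Longrightarrow> z \<in> carrier L \<Longrightarrow>
    z \<otimes>\<^bsub>L\<^esub> x = y \<Longrightarrow> z \<in> subloop_gen L A"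

definition generated_subloop :: "('b, 'c) monoid_scheme \<Rightarrow> 'b set \<Rightarrow> ('b, 'c) monoid_scheme" where
  "generated_subloop L A = L\<lparr>carrier := subloop_gen L A\<rparr>"

text \<open>A word is a list of letters; the letter \<open>(x, False)\<close> stands for the generator \<open>x\<close> and
  \<open>(x, True)\<close> for its formal inverse. All elements of the type \<^typ>\<open>'g\<close> are generators.\<close>

type_synonym 'g word = "('g \<times> bool) list"

text \<open>Two words are equal in the group presented by the relators \<open>R\<close> iff they are related by the
  least congruence making each \<open>x x\<^sup>-\<^sup>1\<close>, each \<open>x\<^sup>-\<^sup>1 x\<close> and each relator trivial.\<close>

inductive word_eq :: "'g word set \<Rightarrow> 'g word \<Rightarrow> 'g word \<Rightarrow> bool" for R :: "'g word set" where
  cancel: "word_eq R [(x, e), (x, \<not> e)] []"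
| relator: "r \<in> R \<Longrightarrow> word_eq R r []"
| refl: "word_eq R v v"
| sym: "word_eq R v w \<Longrightarrow> word_eq R w v"
| trans: "word_eq R u v \<Longrightarrow> word_eq R v w \<Longrightarrow> word_eq R u w"
| append: "word_eq R v v' \<Longrightarrow> word_eq R w w' \<Longrightarrow> word_eq R (v @ w) (v' @ w')"

definition word_rel :: "'g word set \<Rightarrow> ('g word \<times> 'g word) set" where
  "word_rel R = {(v, w). word_eq R v w}"

definition presented_group :: "'g word set \<Rightarrow> 'g word set monoid" where
  "presented_group R =
     \<lparr>carrier = UNIV // word_rel R,
      monoid.mult = (\<lambda>A B. \<Union>v\<in>A. \<Union>w\<in>B. word_rel R `` {v @ w}),
      one = word_rel R `` {[]}\<rparr>"

lemma equiv_word_rel: "equiv UNIV (word_rel R)"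
  by (rule equivI) (auto simp: word_rel_def refl_on_def sym_def trans_def intro: word_eq.intros)

lemma presented_group_mult:
  "word_rel R `` {v} \<otimes>\<^bsub>presented_group R\<^esub> word_rel R `` {w} = word_rel R `` {v @ w}"
proof -
  have *: "word_rel R `` {v' @ w'} = word_rel R `` {v @ w}"
    if "v' \<in> word_rel R `` {v}" "w' \<in> word_rel R `` {w}" for v' w'
  proof (rule equiv_class_eq[OF equiv_word_rel, symmetric])
    show "(v @ w, v' @ w') \<in> word_rel R"
      using that by (simp add: word_rel_def word_eq.append)
  qed
  have m: "v \<in> word_rel R `` {v}" "w \<in> word_rel R `` {w}"
    by (simp_all add: word_rel_def word_eq.refl)
  have "(\<Union>v'\<in>word_rel R `` {v}. \<Union>w'\<in>word_rel R `` {w}. word_rel R `` {v' @ w'}) =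
        (\<Union>v'\<in>word_rel R `` {v}. \<Union>w'\<in>word_rel R `` {w}. word_rel R `` {v @ w})"
    by (intro SUP_cong HOL.refl *)
  also have "\<dots> = word_rel R `` {v @ w}"
    using m by blast
  finally show ?thesis
    by (simp add: presented_group_def)
qed

lemma group_presented_group: "group (presented_group R)"
proof (rule groupI)
  have car: "\<exists>v. A = word_rel R `` {v}" if "A \<in> carrier (presented_group R)" for A
    using that by (auto simp: presented_group_def quotient_def)
  have in_car: "word_rel R `` {v} \<in> carrier (presented_group R)" for v
    by (auto simp: presented_group_def quotient_def)
  have one: "\<one>\<^bsub>presented_group R\<^esub> = word_rel R `` {[]}"
    by (simp add: presented_group_def)
  show "\<one>\<^bsub>presented_group R\<^esub> \<in> carrier (presented_group R)"
    by (simp add: one in_car)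
  fix A assume A: "A \<in> carrier (presented_group R)"
  then obtain v where v: "A = word_rel R `` {v}" using car by blast
  show "\<one>\<^bsub>presented_group R\<^esub> \<otimes>\<^bsub>presented_group R\<^esub> A = A"
    by (simp add: one v presented_group_mult)
  have "\<exists>v'. word_eq R (v' @ v) []"
  proof (induction v)
    case Nil
    show ?case by (rule exI[of _ "[]"]) (simp add: word_eq.refl)
  next
    case (Cons l v)
    then obtain v' where v': "word_eq R (v' @ v) []" by blast
    obtain x e where l: "l = (x, e)" by (cases l)
    have "word_eq R [(x, \<not> e), l] []"
      using word_eq.cancel[of R x "\<not> e"] by (simp add: l)
    then have "word_eq R (v' @ ([(x, \<not> e), l] @ v)) (v' @ ([] @ v))"
      by (intro word_eq.append word_eq.refl)
    then have "word_eq R ((v' @ [(x, \<not> e)]) @ l # v) []"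
      using v' by (auto intro: word_eq.trans)
    then show ?case by blast
  qed
  then obtain v' where "word_eq R (v' @ v) []" by blast
  then have "word_rel R `` {v'} \<otimes>\<^bsub>presented_group R\<^esub> A = \<one>\<^bsub>presented_group R\<^esub>"
    unfolding v one presented_group_mult
    by (intro equiv_class_eq[OF equiv_word_rel]) (simp add: word_rel_def)
  then show "\<exists>B\<in>carrier (presented_group R). B \<otimes>\<^bsub>presented_group R\<^esub> A = \<one>\<^bsub>presented_group R\<^esub>"
    using in_car by blast
  fix B assume B: "B \<in> carrier (presented_group R)"
  then obtain w where w: "B = word_rel R `` {w}" using car by blast
  show "A \<otimes>\<^bsub>presented_group R\<^esub> B \<in> carrier (presented_group R)"
    by (simp add: v w presented_group_mult in_car)
  fix C assume "C \<in> carrier (presented_group R)"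
  then obtain u where u: "C = word_rel R `` {u}" using car by blast
  show "A \<otimes>\<^bsub>presented_group R\<^esub> B \<otimes>\<^bsub>presented_group R\<^esub> C =
        A \<otimes>\<^bsub>presented_group R\<^esub> (B \<otimes>\<^bsub>presented_group R\<^esub> C)"
    by (simp add: v w u presented_group_mult)
qed

datatype gen2 = X | Y

definition word_power :: "'g word \<Rightarrow> nat \<Rightarrow> 'g word" where
  "word_power w n = concat (replicate n w)"

definition group_33_3 :: "nat \<Rightarrow> gen2 word set monoid" where
  "group_33_3 n = presented_group
     {word_power [(X, False)] 3,
      word_power [(Y, False)] 3,
      word_power [(X, False), (Y, False)] 3,
      word_power [(X, True), (Y, False)] n}"

definition primitive_element :: "'a::field \<Rightarrow> bool" where
  "primitive_element u \<longleftrightarrow> u \<noteq> 0 \<and> (\<forall>x. x \<noteq> 0 \<longrightarrow> (\<exists>k::int. x = u powi k))"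

definition g3 :: "'a::field \<Rightarrow> 'a zorn set" where
  "g3 u = zorn_class (Zorn 0 (vector [0, 0, u]) (vector [0, 0, - inverse u]) 1)"

definition g4 :: "'a::field \<Rightarrow> 'a zorn set" where
  "g4 u = zorn_class (Zorn 0 (vector [0, 0, u]) (vector [0, u, - inverse u]) 1)"

definition g5 :: "'a::field \<Rightarrow> 'a zorn set" where
  "g5 u = zorn_class (Zorn 0 (vector [0, 0, u]) (vector [- u, 0, - inverse u]) 1)"

lemma g345_in_paige_loop:
  assumes "u \<noteq> 0"
  shows "g3 u \<in> carrier paige_loop" "g4 u \<in> carrier paige_loop" "g5 u \<in> carrier paige_loop"
  using assms by (auto simp: g3_def g4_def g5_def paige_loop_def dot3_def sum_3 vector_3)

end

theory Submission
  imports Defs "HOL-Number_Theory.Residues"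
begin

text \<open>
  The three matrices share the top row \<open>(0, \<gamma>)\<close> and the corner entry \<open>1\<close>; they differ only in the
  lower left vector, and \<open>\<gamma>\<close> has dot product \<open>-1\<close> with each of these vectors. Let \<open>g\<close> and \<open>h\<close> be two
  such matrices, with linearly independent lower left vectors \<open>\<beta>\<close> and \<open>\<delta>\<close>, and put
  \<open>v = \<beta> \<times> \<delta>\<close>, \<open>w = \<delta> - \<beta>\<close>. The argument works for every such pair over any field of positive
  characteristic \<open>p\<close>.

  Write \<open>V\<close> and \<open>W\<close> for the vector matrices whose only nonzero entry is \<open>v\<close> at the upper right,
  respectively \<open>w\<close> at the lower left. Then \<open>V\<close> and \<open>W\<close> have all mutual products zero, \<open>g\<^sup>2 = g - 1\<close>,
  \<open>gV = W\<close>, \<open>Vg = V - W\<close>, \<open>gW = W - V\<close> and \<open>Wg = V\<close>. Hence \<open>1, V, W, g\<close> span a subalgebra containing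
  \<open>h = g + W\<close>, and reading off its multiplication table (\<open>elt_mult\<close>) shows that it is associative.
  So a word in \<open>g, h\<close> has a well-defined value that is multiplicative in the word. Since \<open>g\<close>, \<open>h\<close>
  and \<open>gh\<close> have cubes \<open>\<plusminus>1\<close> and \<open>g\<^sup>-\<^sup>1h = 1 + V\<close> has order \<open>p\<close>, the relators of \<open>(3,3|3,p)\<close>
  take the value \<open>\<plusminus>1\<close> (\<open>word_eq_imp_class_eq\<close>), and evaluation is a homomorphism into the loop. Its
  image is the whole subloop generated by \<open>g\<close> and \<open>h\<close>, since in the Zorn algebra division by a matrix
  of determinant \<open>1\<close> is multiplication by its conjugate.

  For injectivity, put \<open>t = x\<^sup>-\<^sup>1y\<close> and \<open>s = yx\<^sup>-\<^sup>1\<close> in \<open>(3,3|3,p)\<close>. The relations make \<open>t\<close> and \<open>s\<close>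
  commute and make conjugation by \<open>x\<close> send \<open>t\<close> to \<open>s\<close> and \<open>s\<close> to \<open>(ts)\<^sup>-\<^sup>1\<close>, so every element has the form
  \<open>t\<^sup>i s\<^sup>j x\<^sup>k\<close> with \<open>k < 3\<close> (\<open>group_33_3_normal_form\<close>). Its value is
  \<open>(1 + (i - j)V + jW) g\<^sup>k\<close>, which is \<open>\<plusminus>1\<close> only if \<open>k = 0\<close> and \<open>p\<close> divides \<open>i\<close> and \<open>j\<close>, and then
  \<open>t\<^sup>i s\<^sup>j x\<^sup>k = 1\<close>.
\<close>

section \<open>Conjugation in the Zorn algebra\<close>

fun zorn_conj :: "'a::comm_ring_1 zorn \<Rightarrow> 'a zorn" where
  "zorn_conj (Zorn a \<alpha> \<beta> b) = Zorn b (- \<alpha>) (- \<beta>) a"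

lemma zorn_conj_conj [simp]: "zorn_conj (zorn_conj M) = M"
  by (cases M) simp

lemma zorn_det_conj [simp]: "zorn_det (zorn_conj M) = zorn_det M"
  by (cases M) (simp add: dot3_def sum_3 mult.commute)

lemma zorn_conj_mult: "zorn_conj (zorn_mult M N) = zorn_mult (zorn_conj N) (zorn_conj M)"
  by (cases M; cases N)
    (simp add: dot3_def cross3_def sum_3 vec_eq_iff forall_3 vector_3 algebra_simps)

lemma zorn_det_mult: "zorn_det (zorn_mult M N) = zorn_det M * zorn_det N"
  by (cases M; cases N) (simp add: dot3_def cross3_def sum_3 vector_3 algebra_simps)

text \<open>The Zorn algebra is alternative, so division by a matrix of determinant \<open>1\<close> is multiplication
  by its conjugate, even though the other factor is arbitrary.\<close>

lemma zorn_conj_mult_cancel_left: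
  assumes "zorn_det M = 1"
  shows "zorn_mult (zorn_conj M) (zorn_mult M N) = N"
proof -
  obtain a \<alpha> \<beta> b where M: "M = Zorn a \<alpha> \<beta> b" by (cases M)
  obtain c \<gamma> \<delta> d where N: "N = Zorn c \<gamma> \<delta> d" by (cases N)
  (* The determinant is kept as a factor, which makes this a polynomial identity. *)
  have "zorn_mult (zorn_conj M) (zorn_mult M N) =
    Zorn (zorn_det M * c) (zorn_det M *s \<gamma>) (zorn_det M *s \<delta>) (zorn_det M * d)"
    by (simp add: M N dot3_def cross3_def sum_3 vec_eq_iff forall_3 vector_3 algebra_simps)
  with assms show ?thesis by (simp add: N)
qed

lemma zorn_conj_mult_cancel_right:
  assumes "zorn_det M = 1"
  shows "zorn_mult (zorn_mult N M) (zorn_conj M) = N"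
proof -
  have "zorn_conj (zorn_mult (zorn_mult N M) (zorn_conj M)) = zorn_conj N"
    using zorn_conj_mult_cancel_left[of "zorn_conj M" "zorn_conj N"] assms
    by (simp add: zorn_conj_mult)
  then show ?thesis by (metis zorn_conj_conj)
qed

lemma zorn_uminus_uminus [simp]: "zorn_uminus (zorn_uminus M) = M"
  by (cases M) simp

lemma zorn_class_eq_iff: "zorn_class M = zorn_class N \<longleftrightarrow> M = N \<or> M = zorn_uminus N"
  by (auto simp: zorn_class_def doubleton_eq_iff)

section \<open>The associative subalgebra containing two generators\<close>

text \<open>The generators are \<open>g = Zorn 0 \<gamma> \<beta> 1\<close> and \<open>h = Zorn 0 \<gamma> \<delta> 1\<close>. The conditions on \<open>\<gamma>\<close> give
  them determinant \<open>1\<close>, and a nonzero cross product is linear independence.\<close>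

locale zorn_pencil =
  fixes \<beta> \<gamma> \<delta> :: "'a::field ^ 3"
  assumes dot_\<beta>: "dot3 \<gamma> \<beta> = - 1" and dot_\<delta>: "dot3 \<gamma> \<delta> = - 1"
    and independent: "cross3 \<beta> \<delta> \<noteq> 0"
begin

text \<open>The linear combination \<open>a + bV + cW + dg\<close>; in particular \<open>h\<close> is \<open>elt 0 0 1 1\<close>.\<close>

definition elt :: "'a \<Rightarrow> 'a \<Rightarrow> 'a \<Rightarrow> 'a \<Rightarrow> 'a zorn" where
  "elt a b c d = Zorn a (b *s cross3 \<beta> \<delta> + d *s \<gamma>) (c *s (\<delta> - \<beta>) + d *s \<beta>) (a + d)"

text \<open>The span of \<open>1, V, W, g\<close> is closed under multiplication because \<open>v\<close> is orthogonal to \<open>\<beta>\<close> and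
  \<open>\<delta>\<close>, because \<open>\<gamma>\<close> is orthogonal to \<open>w\<close>, and because the triple product expansion gives
  \<open>v \<times> \<gamma> = (\<gamma> \<cdot> \<beta>) \<delta> - (\<gamma> \<cdot> \<delta>) \<beta> = - w\<close>.\<close>

lemma elt_mult:
  "zorn_mult (elt a b c d) (elt a' b' c' d') =
   elt (a * a' - d * d') (a * b' + b * a' + b * d' + c * d' - d * c')
     (a * c' + c * a' - b * d' + d * b' + d * c') (a * d' + d * a' + d * d')"
proof -
  define v where "v = cross3 \<beta> \<delta>"
  define w where "w = \<delta> - \<beta>"
  have dots: "dot3 v w = 0" "dot3 v \<beta> = 0" "dot3 \<gamma> w = 0" "dot3 w v = 0" "dot3 \<beta> v = 0" "dot3 w \<gamma> = 0"
      "dot3 \<beta> \<gamma> = - 1"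
    using dot_\<beta> dot_\<delta>
    by (simp_all add: v_def w_def dot3_def cross3_def sum_3 vector_3 algebra_simps)
  have v: "cross3 w \<beta> = - v"
    by (simp add: v_def w_def cross3_def vec_eq_iff forall_3 vector_3 algebra_simps)
  have w: "cross3 v \<gamma> = - w"
  proof -
    have "cross3 v \<gamma> = dot3 \<gamma> \<beta> *s \<delta> - dot3 \<gamma> \<delta> *s \<beta>"
      by (simp add: v_def dot3_def cross3_def sum_3 vec_eq_iff forall_3 vector_3 algebra_simps)
    then show ?thesis by (simp add: dot_\<beta> dot_\<delta> w_def vec_eq_iff)
  qed
  have dot_lin: "dot3 (r *s y + s *s z) (r' *s y' + s' *s z') =
      r * r' * dot3 y y' + r * s' * dot3 y z' + s * r' * dot3 z y' + s * s' * dot3 z z'"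
    for r s r' s' :: 'a and y z y' z'
    by (simp add: dot3_def sum_3 algebra_simps)
  have cross_lin: "cross3 (r *s y + s *s z) (r' *s y + s' *s z) = (r * s' - s * r') *s cross3 y z"
    for r s r' s' :: 'a and y z
    by (simp add: cross3_def vec_eq_iff forall_3 vector_3 algebra_simps)
  show ?thesis
    unfolding elt_def v_def[symmetric] w_def[symmetric]
    by (simp add: dot_lin cross_lin dots dot_\<beta> v w) (simp add: vec_eq_iff algebra_simps)
qed

definition pencil_algebra :: "'a zorn set" where
  "pencil_algebra = {M. \<exists>a b c d. M = elt a b c d}"

lemma elt_in_pencil_algebra [simp]: "elt a b c d \<in> pencil_algebra"
  by (auto simp: pencil_algebra_def)

lemma pencil_algebraE:
  assumes "M \<in> pencil_algebra"
  obtains a b c d where "M = elt a b c d"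
  using assms by (auto simp: pencil_algebra_def)

lemma pencil_algebra_mult:
  "M \<in> pencil_algebra \<Longrightarrow> N \<in> pencil_algebra \<Longrightarrow> zorn_mult M N \<in> pencil_algebra"
  by (auto simp: elt_mult elim!: pencil_algebraE)

lemma pencil_algebra_assoc:
  assumes "M \<in> pencil_algebra" "N \<in> pencil_algebra" "K \<in> pencil_algebra"
  shows "zorn_mult (zorn_mult M N) K = zorn_mult M (zorn_mult N K)"
proof -
  have cong: "elt a b c d = elt a' b' c' d'" if "a = a'" "b = b'" "c = c'" "d = d'"
    for a b c d a' b' c' d' using that by simp
  from assms show ?thesis
    by (elim pencil_algebraE) (simp add: elt_mult, rule cong; simp add: algebra_simps)
qed

lemma zorn_conj_elt: "zorn_conj (elt a b c d) = elt (a + d) (- b) (- c) (- d)"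
  by (simp add: elt_def vec_eq_iff)

lemma zorn_det_elt: "zorn_det (elt a b c d) = a * a + a * d + d * d"
proof -
  (* The determinant is read off from the product of a matrix with its conjugate, so that the
     multiplication table can be used again. *)
  have "zorn_mult M (zorn_conj M) = Zorn (zorn_det M) 0 0 (zorn_det M)" for M :: "'a zorn"
    by (cases M) (simp add: dot3_def cross3_def sum_3 vec_eq_iff forall_3 vector_3 algebra_simps)
  moreover have "zorn_mult (elt a b c d) (zorn_conj (elt a b c d)) =
      elt (a * a + a * d + d * d) 0 0 0"
    by (simp add: zorn_conj_elt elt_mult algebra_simps)
  ultimately have "elt (a * a + a * d + d * d) 0 0 0 =
      Zorn (zorn_det (elt a b c d)) 0 0 (zorn_det (elt a b c d))" by metis
  then show ?thesis by (simp add: elt_def)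
qed

lemma elt_one: "elt 1 0 0 0 = Zorn 1 0 0 1"
  by (simp add: elt_def)

lemma zorn_uminus_elt: "zorn_uminus (elt a b c d) = elt (- a) (- b) (- c) (- d)"
  by (simp add: elt_def vec_eq_iff)

text \<open>Here the independence of \<open>\<beta>\<close> and \<open>\<delta>\<close> enters: it makes \<open>v\<close> and \<open>w\<close> nonzero.\<close>

lemma elt_scalar_class:
  assumes "zorn_class (elt a b c d) = zorn_class (elt 1 0 0 0)"
  shows "b = 0" "c = 0" "d = 0"
proof -
  have ne: "\<delta> - \<beta> \<noteq> 0"
  proof
    assume "\<delta> - \<beta> = 0"
    then have "\<delta> = \<beta>" by simp
    then have "cross3 \<beta> \<delta> = 0"
      by (simp add: cross3_def vec_eq_iff forall_3 vector_3 mult.commute)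
    with independent show False ..
  qed
  from assms have e: "elt a b c d = elt 1 0 0 0 \<or> elt a b c d = elt (-1) 0 0 0"
    by (simp add: zorn_class_eq_iff zorn_uminus_elt)
  then show d: "d = 0" by (auto simp: elt_def)
  from e d have "b *s cross3 \<beta> \<delta> = 0" "c *s (\<delta> - \<beta>) = 0"
    by (auto simp: elt_def)
  with ne independent show "b = 0" "c = 0" by (simp_all add: vector_mul_eq_0)
qed

end

section \<open>Evaluating words\<close>

definition relators_33_3 :: "nat \<Rightarrow> gen2 word set" where
  "relators_33_3 n = {word_power [(X, False)] 3, word_power [(Y, False)] 3,
     word_power [(X, False), (Y, False)] 3, word_power [(X, True), (Y, False)] n}"

context zorn_pencil
begin

text \<open>The values of \<open>X\<close> and \<open>Y\<close> are \<open>g\<close> and \<open>h = g + W\<close>; those of the inverse letters are the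
  conjugates \<open>1 - g\<close> and \<open>1 - g - W\<close>.\<close>

fun letter_val :: "gen2 \<times> bool \<Rightarrow> 'a zorn" where
  "letter_val (X, False) = elt 0 0 0 1"
| "letter_val (X, True) = elt 1 0 0 (- 1)"
| "letter_val (Y, False) = elt 0 0 1 1"
| "letter_val (Y, True) = elt 1 0 (- 1) (- 1)"

definition word_val :: "gen2 word \<Rightarrow> 'a zorn" where
  "word_val w = foldr (\<lambda>l. zorn_mult (letter_val l)) w (elt 1 0 0 0)"

lemma word_val_Nil: "word_val [] = elt 1 0 0 0"
  and word_val_Cons: "word_val (l # w) = zorn_mult (letter_val l) (word_val w)"
  by (simp_all add: word_val_def)

lemma letter_val_in_pencil_algebra: "letter_val l \<in> pencil_algebra"
  by (cases l rule: letter_val.cases) auto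

lemma word_val_in_pencil_algebra: "word_val w \<in> pencil_algebra"
  by (induction w)
    (simp_all add: word_val_Nil word_val_Cons letter_val_in_pencil_algebra pencil_algebra_mult)

lemma elt_one_mult: "M \<in> pencil_algebra \<Longrightarrow> zorn_mult (elt 1 0 0 0) M = M"
  by (auto simp: elt_mult elim!: pencil_algebraE)

lemma word_val_append: "word_val (v @ w) = zorn_mult (word_val v) (word_val w)"
  by (induction v)
    (simp_all add: word_val_Nil word_val_Cons elt_one_mult word_val_in_pencil_algebra
      letter_val_in_pencil_algebra pencil_algebra_assoc)

lemma word_val_single: "word_val [l] = letter_val l"
  by (cases l rule: letter_val.cases) (simp_all add: word_val_Nil word_val_Cons elt_mult)

lemma zorn_det_word_val: "zorn_det (word_val w) = 1"
proof (induction w)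
  case Nil
  show ?case by (simp add: word_val_Nil zorn_det_elt)
next
  case (Cons l w)
  have "zorn_det (letter_val l) = 1"
    by (cases l rule: letter_val.cases) (simp_all add: zorn_det_elt)
  with Cons show ?case by (simp add: word_val_Cons zorn_det_mult)
qed

text \<open>The conjugate of a value is the value of the formal inverse of the word. This keeps quotients
  by values of words within the values of words.\<close>

lemma zorn_conj_word_val: "zorn_conj (word_val w) = word_val (rev (map (apsnd Not) w))"
proof (induction w)
  case Nil
  show ?case by (simp add: word_val_Nil zorn_conj_elt)
next
  case (Cons l w)
  have "zorn_conj (letter_val l) = letter_val (apsnd Not l)"
    by (cases l rule: letter_val.cases) (simp_all add: zorn_conj_elt)
  with Cons show ?case
    by (simp add: word_val_Cons[of l w] word_val_append zorn_conj_mult word_val_single)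
qed

text \<open>The values of \<open>x\<^sup>-\<^sup>1y\<close> and \<open>yx\<^sup>-\<^sup>1\<close> are \<open>1 + V\<close> and \<open>1 - V + W\<close>; as \<open>V\<close> and \<open>W\<close> multiply to zero,
  powers of these add up in the exponents.\<close>

lemma word_val_power_translation:
  "word_val (word_power [(X, True), (Y, False)] i) = elt 1 (of_nat i) 0 0"
  "word_val (word_power [(Y, False), (X, True)] i) = elt 1 (- of_nat i) (of_nat i) 0"
  by (induction i)
    (simp_all add: word_power_def word_val_append word_val_Cons word_val_Nil elt_mult algebra_simps)

text \<open>The values are compared as elements of the Paige loop, since the cubes of \<open>g\<close> and of \<open>h\<close>
  are \<open>-1\<close>.\<close>

lemma word_eq_imp_class_eq:
  "word_eq (relators_33_3 CHAR('a)) v w \<Longrightarrow> zorn_class (word_val v) = zorn_class (word_val w)"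
proof (induction rule: word_eq.induct)
  case (cancel x e)
  have "word_val [(x, e), (x, \<not> e)] = elt 1 0 0 0"
    by (cases x; cases e) (simp_all add: word_val_Cons word_val_Nil elt_mult)
  then show ?case by (simp add: word_val_Nil)
next
  case (relator r)
  then consider "r = word_power [(X, False)] 3" | "r = word_power [(Y, False)] 3" |
    "r = word_power [(X, False), (Y, False)] 3" |
    "r = word_power [(X, True), (Y, False)] CHAR('a)" unfolding relators_33_3_def by blast
  then show ?case
  proof cases
    case 4
    then show ?thesis by (simp add: word_val_power_translation word_val_Nil)
  qed (simp_all add: word_power_def eval_nat_numeral zorn_class_eq_iff word_val_Cons word_val_Nil
         elt_mult zorn_uminus_elt)
next
  case (append v v' w w')
  then show ?case by (metis word_val_append zorn_class_mult)
qed simp_all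

end

section \<open>A normal form in groups satisfying the relations\<close>

locale triangle_group = group +
  fixes x y and n :: nat
  assumes x: "x \<in> carrier G" and y: "y \<in> carrier G"
    and x_cube: "x \<otimes> (x \<otimes> x) = \<one>" and y_cube: "y \<otimes> (y \<otimes> y) = \<one>"
    and xy_cube: "(x \<otimes> y) \<otimes> ((x \<otimes> y) \<otimes> (x \<otimes> y)) = \<one>"
    and translation_order: "(inv x \<otimes> y) [^] n = \<one>" and n_pos: "n > 0"
begin

text \<open>The group given by the first three relators is the orientation preserving triangle group of
  the tiling of the Euclidean plane by equilateral triangles, with \<open>x\<close> and \<open>y\<close> rotations by a third
  of a turn. The elements \<open>t\<close> and \<open>s\<close> below are two independent translations.\<close>

definition "t = inv x \<otimes> y"
definition "s = y \<otimes> inv x"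

lemma t: "t \<in> carrier G" and s: "s \<in> carrier G"
  using x y by (simp_all add: t_def s_def)

lemmas closed = x y t s

lemma inv_x: "inv x = x \<otimes> x" and inv_y: "inv y = y \<otimes> y"
  using x y x_cube y_cube by (auto intro!: inv_equality simp: m_assoc)

lemma x_t: "x \<otimes> t = y"
  using x y by (simp add: t_def m_assoc[symmetric])

lemma s_x: "s \<otimes> x = y"
  using x y by (simp add: s_def m_assoc)

lemma x_cancel: "z \<in> carrier G \<Longrightarrow> x \<otimes> (x \<otimes> (x \<otimes> z)) = z"
  using arg_cong[OF x_cube, of "\<lambda>u. u \<otimes> z"] x by (simp add: m_assoc)

lemma s_t: "s \<otimes> t = y \<otimes> (x \<otimes> y)"
  using x y by (simp add: s_def t_def inv_x m_assoc x_cancel)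

lemma yxy_eq: "y \<otimes> (x \<otimes> y) = inv (x \<otimes> (y \<otimes> x))"
proof -
  have "(x \<otimes> (y \<otimes> x)) \<otimes> (y \<otimes> (x \<otimes> y)) = \<one>"
    using xy_cube x y by (simp add: m_assoc)
  then have "inv (y \<otimes> (x \<otimes> y)) = x \<otimes> (y \<otimes> x)"
    using x y by (intro inv_equality) simp_all
  then have "inv (inv (y \<otimes> (x \<otimes> y))) = inv (x \<otimes> (y \<otimes> x))" by simp
  then show ?thesis using x y by (simp only: inv_inv m_closed)
qed

text \<open>Both products are \<open>(xyx)\<^sup>-\<^sup>1\<close>; for \<open>st = yxy\<close> this is the relation \<open>(xy)\<^sup>3 = 1\<close>.\<close>

lemma t_s_commute: "t \<otimes> s = s \<otimes> t"
proof -
  have "inv (x \<otimes> (y \<otimes> x)) = t \<otimes> s"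
    using x y by (simp add: inv_mult_group inv_x inv_y t_def s_def m_assoc)
  with s_t yxy_eq show ?thesis by simp
qed

lemma x_t_pow: "x \<otimes> t [^] (m::nat) = s [^] m \<otimes> x"
proof (induction m)
  case 0
  then show ?case using x by simp
next
  case (Suc m)
  have "x \<otimes> t [^] Suc m = s [^] m \<otimes> (x \<otimes> t)"
    using Suc closed by (simp add: m_assoc[symmetric])
  also have "\<dots> = s [^] Suc m \<otimes> x" using closed by (simp add: x_t s_x m_assoc)
  finally show ?case .
qed

lemma t_order: "t [^] n = \<one>"
  using translation_order by (simp add: t_def)

lemma s_order: "s [^] n = \<one>"
  using x_t_pow[of n] t_order closed by simp

lemma t_s_inverse: "(t \<otimes> s) [^] (n - 1) \<otimes> (t \<otimes> s) = \<one>"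
proof -
  have "(t \<otimes> s) [^] Suc (n - 1) = \<one>"
    using pow_mult_distrib[OF t_s_commute t s, of n] t_order s_order n_pos by simp
  then show ?thesis by (simp only: nat_pow_Suc)
qed

text \<open>That conjugation by \<open>x\<close> sends \<open>s\<close> to \<open>(ts)\<^sup>-\<^sup>1\<close> amounts to \<open>ts \<cdot> xs = x\<close>, which after inserting
  \<open>ts = yxy\<close> is again \<open>(xy)\<^sup>3 = 1\<close>. The inverse is written as a power with a natural exponent, so that
  all normal forms are spelled by words with natural exponents.\<close>

lemma x_s: "x \<otimes> s = (t \<otimes> s) [^] (n - 1) \<otimes> x"
proof -
  have "x \<otimes> (inv x \<otimes> inv x) = inv x" using x by (simp add: m_assoc[symmetric])
  then have "(y \<otimes> (x \<otimes> y)) \<otimes> (x \<otimes> (y \<otimes> inv x)) =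
      ((y \<otimes> (x \<otimes> y)) \<otimes> (x \<otimes> (y \<otimes> x))) \<otimes> (inv x \<otimes> inv x)"
    using x y by (simp add: m_assoc)
  also have "(y \<otimes> (x \<otimes> y)) \<otimes> (x \<otimes> (y \<otimes> x)) = \<one>"
    using yxy_eq x y by simp
  also have "\<one> \<otimes> (inv x \<otimes> inv x) = x"
    using x by (simp add: inv_x m_assoc x_cancel x_cube)
  finally have "(t \<otimes> s) \<otimes> (x \<otimes> s) = x"
    by (simp only: t_s_commute s_t) (simp only: s_def)
  then have "(t \<otimes> s) [^] (n - 1) \<otimes> ((t \<otimes> s) \<otimes> (x \<otimes> s)) = (t \<otimes> s) [^] (n - 1) \<otimes> x"
    by (simp only:)
  moreover have "(t \<otimes> s) [^] (n - 1) \<otimes> ((t \<otimes> s) \<otimes> (x \<otimes> s)) = x \<otimes> s"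
    by (subst m_assoc[symmetric]) (use closed in \<open>simp_all only: t_s_inverse m_closed nat_pow_closed l_one\<close>)
  ultimately show ?thesis by (simp only:)
qed

lemma x_s_pow: "x \<otimes> s [^] (j::nat) = t [^] ((n - 1) * j) \<otimes> s [^] ((n - 1) * j) \<otimes> x"
proof -
  define u where "u = (t \<otimes> s) [^] (n - 1)"
  have u: "u \<in> carrier G" using closed by (simp add: u_def)
  have "x \<otimes> s [^] j = u [^] j \<otimes> x"
  proof (induction j)
    case 0
    then show ?case using x by simp
  next
    case (Suc l)
    have "x \<otimes> s [^] Suc l = u [^] l \<otimes> (x \<otimes> s)"
      using Suc closed u by (simp add: m_assoc[symmetric])
    also have "\<dots> = u [^] Suc l \<otimes> x" using closed u by (simp add: x_s[folded u_def] m_assoc)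
    finally show ?case .
  qed
  also have "u [^] j = t [^] ((n - 1) * j) \<otimes> s [^] ((n - 1) * j)"
    using pow_mult_distrib[OF t_s_commute t s, of "(n - 1) * j"] closed
    by (simp add: u_def nat_pow_pow)
  finally show ?thesis .
qed

lemma s_t_pow_commute: "s [^] (i::nat) \<otimes> t [^] (l::nat) = t [^] l \<otimes> s [^] i"
  using group_commutes_pow[of t s l] group_commutes_pow[of s "t [^] l" i] t_s_commute t s by simp

definition normal_forms :: "'a set" where
  "normal_forms = {A. \<exists>i j k. A = t [^] (i::nat) \<otimes> s [^] (j::nat) \<otimes> x [^] (k::nat)}"

lemma normal_forms_carrier: "normal_forms \<subseteq> carrier G"
  using closed by (auto simp: normal_forms_def)

lemma one_normal_form: "\<one> \<in> normal_forms"
proof -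
  have "\<one> = t [^] (0::nat) \<otimes> s [^] (0::nat) \<otimes> x [^] (0::nat)" by simp
  then show ?thesis unfolding normal_forms_def by blast
qed

lemma x_mult_normal_form: "A \<in> normal_forms \<Longrightarrow> x \<otimes> A \<in> normal_forms"
proof -
  have "x \<otimes> (t [^] i \<otimes> s [^] j \<otimes> x [^] k) =
      t [^] ((n - 1) * j) \<otimes> s [^] (i + (n - 1) * j) \<otimes> x [^] Suc k" for i j k :: nat
  proof -
    have "x \<otimes> (t [^] i \<otimes> s [^] j \<otimes> x [^] k) = (x \<otimes> t [^] i) \<otimes> s [^] j \<otimes> x [^] k"
      using closed by (simp add: m_assoc)
    also have "\<dots> = s [^] i \<otimes> (x \<otimes> s [^] j) \<otimes> x [^] k"
      using closed by (simp add: x_t_pow m_assoc)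
    also have "\<dots> = (s [^] i \<otimes> t [^] ((n - 1) * j)) \<otimes> s [^] ((n - 1) * j) \<otimes> (x \<otimes> x [^] k)"
      using closed by (simp add: x_s_pow m_assoc)
    also have "\<dots> = t [^] ((n - 1) * j) \<otimes> s [^] (i + (n - 1) * j) \<otimes> (x \<otimes> x [^] k)"
      using closed by (simp add: s_t_pow_commute m_assoc nat_pow_mult[symmetric])
    also have "x \<otimes> x [^] k = x [^] Suc k" using x by (rule nat_pow_Suc2[symmetric])
    finally show ?thesis .
  qed
  then show "A \<in> normal_forms \<Longrightarrow> x \<otimes> A \<in> normal_forms"
    unfolding normal_forms_def by blast
qed

lemma t_mult_normal_form: "A \<in> normal_forms \<Longrightarrow> t \<otimes> A \<in> normal_forms"
proof -
  have "t \<otimes> (t [^] i \<otimes> s [^] j \<otimes> x [^] k) = t [^] Suc i \<otimes> s [^] j \<otimes> x [^] k" for i j k :: nat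
    unfolding nat_pow_Suc2[OF t] using closed by (simp add: m_assoc)
  then show "A \<in> normal_forms \<Longrightarrow> t \<otimes> A \<in> normal_forms"
    unfolding normal_forms_def by blast
qed

lemma y_mult_normal_form:
  assumes "A \<in> normal_forms"
  shows "y \<otimes> A \<in> normal_forms"
proof -
  have "y \<otimes> A = x \<otimes> (t \<otimes> A)"
    using assms normal_forms_carrier closed by (simp add: m_assoc[symmetric] x_t subset_iff)
  with assms show ?thesis by (simp add: x_mult_normal_form t_mult_normal_form)
qed

lemma inv_mult_normal_form:
  assumes "A \<in> normal_forms"
  shows "inv x \<otimes> A \<in> normal_forms" "inv y \<otimes> A \<in> normal_forms"
proof -
  have "A \<in> carrier G" using assms normal_forms_carrier by blast
  with assms x y show "inv x \<otimes> A \<in> normal_forms" "inv y \<otimes> A \<in> normal_forms"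
    by (simp_all add: inv_x inv_y m_assoc x_mult_normal_form y_mult_normal_form)
qed

lemma normal_formsE:
  assumes "A \<in> normal_forms"
  obtains i j k :: nat where "k < 3" "A = t [^] i \<otimes> s [^] j \<otimes> x [^] k"
proof -
  from assms obtain i j k where A: "A = t [^] (i::nat) \<otimes> s [^] (j::nat) \<otimes> x [^] (k::nat)"
    by (auto simp: normal_forms_def)
  have "x [^] (3::nat) = \<one>"
    using x_cube x by (simp add: eval_nat_numeral m_assoc)
  then have "x [^] (3 * (k div 3) + k mod 3) = x [^] (k mod 3)"
    using x by (simp only: nat_pow_mult[symmetric] nat_pow_pow[symmetric]) simp
  then show thesis using that[of "k mod 3" i j] A by simp
qed

end

section \<open>Normal form words\<close>

definition cls :: "nat \<Rightarrow> gen2 word \<Rightarrow> gen2 word set" where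
  "cls n w = word_rel (relators_33_3 n) `` {w}"

lemma group_33_3_eq: "group_33_3 n = presented_group (relators_33_3 n)"
  by (simp add: group_33_3_def relators_33_3_def)

lemma group_group_33_3: "group (group_33_3 n)"
  by (simp add: group_33_3_eq group_presented_group)

lemma cls_mult: "cls n v \<otimes>\<^bsub>group_33_3 n\<^esub> cls n w = cls n (v @ w)"
  by (simp add: cls_def group_33_3_eq presented_group_mult)

lemma carrier_group_33_3: "carrier (group_33_3 n) = range (cls n)"
  by (auto simp: cls_def group_33_3_eq presented_group_def quotient_def)

lemma one_group_33_3: "\<one>\<^bsub>group_33_3 n\<^esub> = cls n []"
  by (simp add: cls_def group_33_3_eq presented_group_def)

lemma cls_eq_iff: "cls n v = cls n w \<longleftrightarrow> word_eq (relators_33_3 n) v w"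
  using eq_equiv_class_iff[OF equiv_word_rel[of "relators_33_3 n"], of v w]
  by (simp add: cls_def word_rel_def)

lemma cls_power: "cls n w [^]\<^bsub>group_33_3 n\<^esub> (k::nat) = cls n (word_power w k)"
proof -
  interpret group "group_33_3 n" by (rule group_group_33_3)
  have "cls n w \<in> carrier (group_33_3 n)" by (simp add: carrier_group_33_3)
  then show ?thesis
  proof (induction k)
    case (Suc k)
    have "cls n w [^]\<^bsub>group_33_3 n\<^esub> Suc k = cls n w \<otimes>\<^bsub>group_33_3 n\<^esub> cls n w [^]\<^bsub>group_33_3 n\<^esub> k"
      using Suc.prems by (rule nat_pow_Suc2)
    with Suc show ?case by (simp add: cls_mult word_power_def)
  qed (simp add: one_group_33_3 word_power_def)
qed

lemma inv_cls_letter: "inv\<^bsub>group_33_3 n\<^esub> (cls n [(x, e)]) = cls n [(x, \<not> e)]"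
proof -
  interpret group "group_33_3 n" by (rule group_group_33_3)
  show ?thesis
    by (rule inv_equality)
      (use word_eq.cancel[of "relators_33_3 n" x "\<not> e"] in
        \<open>simp_all add: cls_mult one_group_33_3 carrier_group_33_3 cls_eq_iff[symmetric]\<close>)
qed

lemma triangle_group_33_3:
  assumes "n > 0"
  shows "triangle_group (group_33_3 n) (cls n [(X, False)]) (cls n [(Y, False)]) n"
proof -
  interpret group "group_33_3 n" by (rule group_group_33_3)
  have rel: "cls n r = cls n []" if "r \<in> relators_33_3 n" for r
    using that by (simp add: cls_eq_iff word_eq.relator)
  show ?thesis
  proof
    show "(inv\<^bsub>group_33_3 n\<^esub> cls n [(X, False)] \<otimes>\<^bsub>group_33_3 n\<^esub> cls n [(Y, False)]) [^]\<^bsub>group_33_3 n\<^esub> n =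
        \<one>\<^bsub>group_33_3 n\<^esub>"
      using rel[of "word_power [(X, True), (Y, False)] n"]
      by (simp add: inv_cls_letter cls_mult cls_power one_group_33_3 relators_33_3_def)
  qed (use assms rel[of "word_power [(X, False)] 3"] rel[of "word_power [(Y, False)] 3"]
      rel[of "word_power [(X, False), (Y, False)] 3"] in
      \<open>simp_all add: carrier_group_33_3 cls_mult one_group_33_3 relators_33_3_def word_power_def
        eval_nat_numeral\<close>)
qed

text \<open>The translations \<open>t\<close> and \<open>s\<close> are spelled out as words here, because it is words that are
  evaluated in the Zorn algebra.\<close>

lemma group_33_3_translations:
  defines "t \<equiv> word_power [(X, True), (Y, False)]" and "s \<equiv> word_power [(Y, False), (X, True)]"
  assumes n: "n > 0"
  shows group_33_3_normal_form:
      "\<exists>i j k. k < 3 \<and> cls n w = cls n (t i @ s j @ word_power [(X, False)] k)"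
    and translation_order: "n dvd i \<Longrightarrow> cls n (t i) = cls n []" "n dvd i \<Longrightarrow> cls n (s i) = cls n []"
proof -
  interpret W: triangle_group "group_33_3 n" "cls n [(X, False)]" "cls n [(Y, False)]" n
    using n by (rule triangle_group_33_3)
  have T: "W.t = cls n [(X, True), (Y, False)]" and S: "W.s = cls n [(Y, False), (X, True)]"
    by (simp_all add: W.t_def W.s_def inv_cls_letter cls_mult)
  have "cls n w \<in> W.normal_forms"
  proof (induction w)
    case Nil
    show ?case using W.one_normal_form by (simp add: one_group_33_3)
  next
    case (Cons l w)
    obtain g e where l: "l = (g, e)" by (cases l)
    have "cls n [l] \<otimes>\<^bsub>group_33_3 n\<^esub> cls n w \<in> W.normal_forms"
      using W.x_mult_normal_form[OF Cons] W.y_mult_normal_form[OF Cons]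
        W.inv_mult_normal_form[OF Cons]
      unfolding l by (cases g; cases e) (simp_all add: inv_cls_letter)
    then show ?case by (simp add: cls_mult)
  qed
  then show "\<exists>i j k. k < 3 \<and> cls n w = cls n (t i @ s j @ word_power [(X, False)] k)"
  proof (rule W.normal_formsE)
    fix i j k :: nat
    assume "k < 3" and "cls n w = W.t [^]\<^bsub>group_33_3 n\<^esub> i \<otimes>\<^bsub>group_33_3 n\<^esub>
      W.s [^]\<^bsub>group_33_3 n\<^esub> j \<otimes>\<^bsub>group_33_3 n\<^esub> cls n [(X, False)] [^]\<^bsub>group_33_3 n\<^esub> k"
    then show ?thesis
      by (intro exI[of _ i] exI[of _ j] exI[of _ k]) (simp add: T S cls_power cls_mult t_def s_def)
  qed
  show "cls n (t i) = cls n []" "cls n (s i) = cls n []" if "n dvd i"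
  proof -
    from that obtain m where i: "i = n * m" by blast
    have "W.t [^]\<^bsub>group_33_3 n\<^esub> i = \<one>\<^bsub>group_33_3 n\<^esub>" "W.s [^]\<^bsub>group_33_3 n\<^esub> i = \<one>\<^bsub>group_33_3 n\<^esub>"
      using W.t_order W.s_order W.t W.s by (simp_all add: i flip: W.nat_pow_pow)
    then show "cls n (t i) = cls n []" "cls n (s i) = cls n []"
      by (simp_all add: T S cls_power t_def s_def one_group_33_3)
  qed
qed

section \<open>The isomorphism\<close>

text \<open>The isomorphism is evaluation of words. Divisions in the loop are by arbitrary elements of the
  carrier, so that the closure of the values under division needs the cancellation laws of the Zorn
  algebra and not only associativity in the span of \<open>1, V, W, g\<close>.\<close>

lemma (in zorn_pencil) generated_subloop_iso:
  assumes char: "CHAR('a) > 0"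
  shows "generated_subloop paige_loop {zorn_class (Zorn 0 \<gamma> \<beta> 1), zorn_class (Zorn 0 \<gamma> \<delta> 1)}
    \<cong> group_33_3 CHAR('a)"
    (is "generated_subloop _ ?A \<cong> _")
proof -
  let ?P = "group_33_3 CHAR('a)"
  let ?L = "paige_loop :: 'a zorn set monoid"
  interpret P: group ?P by (rule group_group_33_3)
  define val where "val w = zorn_class (word_val w)" for w
  have val_append: "val (v @ w) = val v \<otimes>\<^bsub>?L\<^esub> val w" for v w
    by (simp add: val_def word_val_append zorn_class_mult)
  have val_inverse: "val (rev (map (apsnd Not) w)) = zorn_class (zorn_conj (word_val w))" for w
    by (simp add: val_def zorn_conj_word_val)
  have gens: "val [(X, False)] = zorn_class (Zorn 0 \<gamma> \<beta> 1)" "val [(Y, False)] = zorn_class (Zorn 0 \<gamma> \<delta> 1)"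
    by (simp_all add: val_def word_val_single elt_def)
  have val_one: "val [] = \<one>\<^bsub>?L\<^esub>"
    by (simp add: val_def word_val_Nil elt_one paige_loop_def)
  have val_carrier: "val w \<in> carrier ?L" for w
    by (simp add: val_def paige_loop_def zorn_det_word_val)
  have range_val: "range val = subloop_gen ?L ?A"
  proof (intro equalityI subsetI)
    fix M assume "M \<in> range val"
    then obtain w where M: "M = val w" by blast
    have letter: "val [(x, e)] \<in> subloop_gen ?L ?A" for x e
    proof -
      have pos: "val [(x, False)] \<in> subloop_gen ?L ?A"
        by (cases x) (auto simp: gens intro: subloop_gen.incl)
      have "word_val [(x, False), (x, True)] = word_val []"
        by (cases x) (simp_all add: word_val_Cons word_val_Nil elt_mult)
      then have "val [(x, False)] \<otimes>\<^bsub>?L\<^esub> val [(x, True)] = \<one>\<^bsub>?L\<^esub>"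
        unfolding val_append[symmetric] val_one[symmetric] by (simp add: val_def)
      then have "val [(x, True)] \<in> subloop_gen ?L ?A"
        by (rule subloop_gen.ldiv[OF pos subloop_gen.one val_carrier])
      with pos show ?thesis by (cases e) auto
    qed
    have "val w \<in> subloop_gen ?L ?A"
    proof (induction w)
      case Nil
      show ?case by (simp add: val_one subloop_gen.one)
    next
      case (Cons l w)
      then show ?case
        using subloop_gen.mult[OF letter[of "fst l" "snd l"], of "val w"]
        by (simp flip: val_append)
    qed
    with M show "M \<in> subloop_gen ?L ?A" by simp
  next
    fix M assume "M \<in> subloop_gen ?L ?A"
    then show "M \<in> range val"
    proof induction
      case (incl M)
      then show ?case by (auto simp: gens[symmetric])
    next
      case one
      show ?case by (simp add: val_one[symmetric])
    next
      case (mult M N)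
      then show ?case by (auto simp flip: val_append)
    next
      case (ldiv M N K)
      then obtain v w K' where vw: "M = val v" "N = val w" and K: "K = zorn_class K'"
        by (auto simp: paige_loop_def)
      have "val (rev (map (apsnd Not) v) @ w) =
          zorn_class (zorn_conj (word_val v)) \<otimes>\<^bsub>?L\<^esub> (zorn_class (word_val v) \<otimes>\<^bsub>?L\<^esub> zorn_class K')"
        using ldiv.hyps vw K by (simp add: val_append val_inverse) (simp add: val_def)
      also have "\<dots> = K"
        by (simp add: K zorn_class_mult zorn_conj_mult_cancel_left zorn_det_word_val)
      finally show ?case by (metis rangeI)
    next
      case (rdiv M N K)
      then obtain v w K' where vw: "M = val v" "N = val w" and K: "K = zorn_class K'"
        by (auto simp: paige_loop_def)
      have "val (w @ rev (map (apsnd Not) v)) =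
          (zorn_class K' \<otimes>\<^bsub>?L\<^esub> zorn_class (word_val v)) \<otimes>\<^bsub>?L\<^esub> zorn_class (zorn_conj (word_val v))"
        using rdiv.hyps vw K by (simp add: val_append val_inverse) (simp add: val_def)
      also have "\<dots> = K"
        by (simp add: K zorn_class_mult zorn_conj_mult_cancel_right zorn_det_word_val)
      finally show ?case by (metis rangeI)
    qed
  qed
  have kernel: "cls CHAR('a) w = cls CHAR('a) []" if w: "val w = val []" for w
  proof -
    let ?t = "word_power [(X, True), (Y, False)]" and ?s = "word_power [(Y, False), (X, True)]"
    obtain i j k where k: "k < 3" and eq: "cls CHAR('a) w = cls CHAR('a) (?t i @ ?s j @ word_power [(X, False)] k)"
      using group_33_3_normal_form[OF char] by blast
    have "val (?t i @ ?s j @ word_power [(X, False)] k) = val []"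
      using eq w word_eq_imp_class_eq by (simp add: cls_eq_iff val_def)
    then have e: "zorn_class (zorn_mult (elt 1 (of_nat i - of_nat j) (of_nat j) 0)
        (word_val (word_power [(X, False)] k))) = zorn_class (elt 1 0 0 0)"
      by (simp add: val_def word_val_append word_val_power_translation word_val_Nil elt_mult
          word_val_in_pencil_algebra flip: pencil_algebra_assoc)
    (* The powers g and g^2 = g - 1 have coefficient 1 at g, and so has their product with a
       translation; scalars have coefficient 0. *)
    have k0: "k = 0"
    proof (rule ccontr)
      assume "k \<noteq> 0"
      with k consider "k = Suc 0" | "k = Suc (Suc 0)" by linarith
      then have "word_val (word_power [(X, False)] k) = elt (1 - of_nat k) 0 0 1"
        by cases (simp_all add: word_power_def word_val_Cons word_val_Nil elt_mult)
      with e have "zorn_class (zorn_mult (elt 1 (of_nat i - of_nat j) (of_nat j) 0)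
          (elt (1 - of_nat k) 0 0 1)) = zorn_class (elt 1 0 0 0)" by simp
      from elt_scalar_class(3)[OF this[unfolded elt_mult]] show False by simp
    qed
    with e have "zorn_class (elt 1 (of_nat i - of_nat j) (of_nat j) 0) = zorn_class (elt 1 0 0 0)"
      by (simp add: word_power_def word_val_Nil elt_mult)
    from elt_scalar_class(1,2)[OF this] have "CHAR('a) dvd i" "CHAR('a) dvd j"
      by (auto simp flip: of_nat_eq_0_iff_char_dvd)
    then have "cls CHAR('a) (?t i) = cls CHAR('a) []" "cls CHAR('a) (?s j) = cls CHAR('a) []"
      using translation_order[OF char] by blast+
    then show ?thesis
      unfolding eq k0 cls_mult[symmetric] by (simp add: cls_mult word_power_def)
  qed
  define h where "h A = the_elem (val ` A)" for A
  have h: "h (cls CHAR('a) w) = val w" for w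
  proof -
    have "val ` cls CHAR('a) w = {val w}"
    proof (intro equalityI subsetI)
      fix M assume "M \<in> val ` cls CHAR('a) w"
      then show "M \<in> {val w}"
        using word_eq_imp_class_eq by (force simp: val_def cls_def word_rel_def)
    qed (auto simp: cls_def word_rel_def intro: word_eq.refl)
    then show ?thesis by (simp add: h_def)
  qed
  have hom: "h \<in> hom ?P (generated_subloop ?L ?A)"
    by (rule homI) (auto simp: carrier_group_33_3 h cls_mult val_append generated_subloop_def
        simp flip: range_val)
  have "inj_on h (carrier ?P)"
  proof (rule inj_onI)
    fix A B assume A: "A \<in> carrier ?P" and B: "B \<in> carrier ?P" and eq: "h A = h B"
    from A B obtain v w where vw: "A = cls CHAR('a) v" "B = cls CHAR('a) w"
      by (auto simp: carrier_group_33_3)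
    from B obtain u where u: "inv\<^bsub>?P\<^esub> B = cls CHAR('a) u"
      using P.inv_closed by (auto simp: carrier_group_33_3)
    have "cls CHAR('a) (w @ u) = cls CHAR('a) []"
      using P.r_inv[OF B] by (simp add: vw(2)[symmetric] u[symmetric] one_group_33_3 flip: cls_mult)
    then have "val (w @ u) = val []" by (metis h)
    moreover have "val v = val w" using eq by (simp add: vw h)
    ultimately have "val (v @ u) = val []" by (simp add: val_append)
    then have "A \<otimes>\<^bsub>?P\<^esub> inv\<^bsub>?P\<^esub> B = \<one>\<^bsub>?P\<^esub>"
      using kernel[of "v @ u"] by (simp add: vw(1) u cls_mult one_group_33_3)
    then show "A = B" using A B P.inv_equality[of A "inv\<^bsub>?P\<^esub> B"] by simp
  qed
  moreover have "h ` carrier ?P = carrier (generated_subloop ?L ?A)"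
    by (auto simp: carrier_group_33_3 h generated_subloop_def image_image simp flip: range_val)
  ultimately have "h \<in> iso ?P (generated_subloop ?L ?A)"
    using hom by (simp add: iso_def bij_betw_def)
  then show ?thesis by (rule is_isoI[OF P.iso_set_sym])
qed

theorem proposition3p1:
  fixes p r q :: nat and u :: "'a::{field, finite}"
  assumes "prime p" and "r \<ge> 1" and "q = p ^ r"
    and "CARD('a) = q"
    and "(odd q \<and> q \<noteq> 9) \<or> q = 2"
    and "primitive_element u"
  shows "generated_subloop paige_loop {g3 u, g4 u} \<cong> group_33_3 p \<and>
         generated_subloop paige_loop {g3 u, g5 u} \<cong> group_33_3 p \<and>
         generated_subloop paige_loop {g4 u, g5 u} \<cong> group_33_3 p"
proof -
  have u: "u \<noteq> 0" using assms(6) by (simp add: primitive_element_def)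
  have pos: "CHAR('a) > 0" by (rule finite_imp_CHAR_pos) simp
  then have "prime CHAR('a)" by (rule prime_CHAR_semidom)
  moreover have "CHAR('a) dvd p ^ r" using CHAR_dvd_CARD[where 'a = 'a] assms(3,4) by simp
  ultimately have char: "CHAR('a) = p"
    using assms(1) prime_dvd_power primes_dvd_imp_eq by blast
  note vec = dot3_def cross3_def sum_3 vector_3 vec_eq_iff forall_3
  let ?\<gamma> = "vector [0, 0, u] :: 'a ^ 3"
  let ?\<beta>3 = "vector [0, 0, - inverse u] :: 'a ^ 3"
  let ?\<beta>4 = "vector [0, u, - inverse u] :: 'a ^ 3"
  let ?\<beta>5 = "vector [- u, 0, - inverse u] :: 'a ^ 3"
  interpret p34: zorn_pencil ?\<beta>3 ?\<gamma> ?\<beta>4 by unfold_locales (use u in \<open>simp_all add: vec\<close>)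
  interpret p35: zorn_pencil ?\<beta>3 ?\<gamma> ?\<beta>5 by unfold_locales (use u in \<open>simp_all add: vec\<close>)
  interpret p45: zorn_pencil ?\<beta>4 ?\<gamma> ?\<beta>5 by unfold_locales (use u in \<open>simp_all add: vec\<close>)
  show ?thesis
    using p34.generated_subloop_iso[OF pos] p35.generated_subloop_iso[OF pos]
      p45.generated_subloop_iso[OF pos]
    by (simp add: char g3_def g4_def g5_def)
qed

end
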